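(* Let $E,F$ be Banach spaces over the same field $\mathbb K\in\{\mathbb R,\mathbb C\}$, let $U\subseteq E$ be open and let $x\in U$. Assume that $f\colon U\to F$ is such that the second order derivative $D^2f(x)$ exists at the point $x$. Then $D^2f(x)$ is symmetric, that is, $D^2f(x)[u,v]=D^2f(x)[v,u]$ for all $u,v\in E$.
   Context: $\mathcal L(E,F)$ denotes the space of bounded linear operators from $E$ to $F$ with the operator norm. Differentiability: a map $f\colon U\to F$ is differentiable at $x\in U$ if there exists a map $\Phi_x\colon U\to\mathcal L(E,F)$, continuous at $x$, such that $f(y)=f(x)+\Phi_x(y)(y-x)$ for all $y\in U$; then $Df(x):=\Phi_x(x)$ (this is equivalent to Fréchet differentiability, with the same derivative). Second derivative: $D^2f(x)$ exists if $f$ is differentiable at every point of a neighbourhood of $x$ and the map $Df$ (from that neighbourhood into $\mathcal L(E,F)$) is differentiable at $x$; its derivative is $D^2f(x)\in\mathcal L\bigl(E,\mathcal L(E,F)\bigr)$. No continuity of the second derivative is assumed. $\mathcal L\bigl(E,\mathcal L(E,F)\bigr)$ is identified with the space $\mathcal L^2(E\times E;F)$ of bounded bilinear maps $E\times E\to F$ via $D^2f(x)[u,v]:=\bigl(D^2f(x)u\bigr)v$. *)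

theory Defs
  imports "HOL-Analysis.Analysis"
begin

text \<open>
  Banach spaces over a field \<open>'k\<close> are real Banach spaces (class \<open>banach\<close>) together with a
  \<open>'k\<close>-scalar multiplication that extends the real one and for which the norm is homogeneous.
  Both \<open>real\<close> and \<open>complex\<close> are of class \<open>real_normed_field\<close>; by the Gelfand--Mazur theorem every
  type of this class is isometrically isomorphic to one of these two.
\<close>

locale banach_over = vector_space scale
  for scale :: "'k::real_normed_field \<Rightarrow> 'e::banach \<Rightarrow> 'e" +
  assumes scale_of_real: "scale (of_real r) x = r *\<^sub>R x"
    and norm_scale: "norm (scale c x) = norm c * norm x"

lemma banach_over_real: "banach_over ((*\<^sub>R) :: real \<Rightarrow> 'e::banach \<Rightarrow> 'e)"
  by unfold_locales (auto simp: algebra_simps)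

lemma banach_over_complex: "banach_over ((*) :: complex \<Rightarrow> complex \<Rightarrow> complex)"
  by unfold_locales (auto simp: algebra_simps norm_mult scaleR_conv_of_real)

text \<open>
  The bounded \<open>'k\<close>-linear operators from \<open>E\<close> into a subspace \<open>G\<close> of \<open>F\<close>, as a set of bounded
  real-linear operators; \<open>norm\<close> on that type is the operator norm. The parameter \<open>G\<close> is needed
  because the space of \<open>'k\<close>-linear operators is itself only a subspace of a type.
\<close>

definition bounded_ops ::
  "('k \<Rightarrow> 'e \<Rightarrow> 'e) \<Rightarrow> ('k \<Rightarrow> 'f \<Rightarrow> 'f) \<Rightarrow> 'f set \<Rightarrow>
   ('e::real_normed_vector \<Rightarrow>\<^sub>L 'f::real_normed_vector) set"
  where "bounded_ops sE sF G =
    {T. (\<forall>c u. blinfun_apply T (sE c u) = sF c (blinfun_apply T u)) \<and>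
        (\<forall>u. blinfun_apply T u \<in> G)}"

definition scale_op ::
  "('k \<Rightarrow> 'f \<Rightarrow> 'f) \<Rightarrow> 'k \<Rightarrow> ('e::real_normed_vector \<Rightarrow>\<^sub>L 'f::real_normed_vector) \<Rightarrow> ('e \<Rightarrow>\<^sub>L 'f)"
  where "scale_op sF c T = Blinfun (\<lambda>u. sF c (blinfun_apply T u))"

lemma (in banach_over) bounded_linear_scale: "bounded_linear (scale c)"
proof (rule bounded_linear_intro)
  show "scale c (x + y) = scale c x + scale c y" for x y
    by (rule scale_right_distrib)
  show "scale c (r *\<^sub>R x) = r *\<^sub>R scale c x" for r x
    by (simp flip: scale_of_real add: mult.commute)
  show "norm (scale c x) \<le> norm x * norm c" for x
    by (simp add: norm_scale mult.commute)
qed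

lemma (in banach_over) scale_op_apply [simp]:
  "blinfun_apply (scale_op scale c T) u = scale c (blinfun_apply T u)"
  unfolding scale_op_def
  by (subst bounded_linear_Blinfun_apply)
    (auto intro: bounded_linear_compose[OF bounded_linear_scale] blinfun.bounded_linear_right)

lemma (in banach_over) banach_over_scale_op:
  "banach_over (scale_op scale :: 'k \<Rightarrow> ('d::real_normed_vector \<Rightarrow>\<^sub>L 'e) \<Rightarrow> ('d \<Rightarrow>\<^sub>L 'e))"
proof unfold_locales
  fix c :: 'k and T :: "'d \<Rightarrow>\<^sub>L 'e"
  have le: "norm (scale_op scale d S) \<le> norm d * norm S" for d and S :: "'d \<Rightarrow>\<^sub>L 'e"
  proof (rule norm_blinfun_bound)
    show "norm (blinfun_apply (scale_op scale d S) u) \<le> norm d * norm S * norm u" for u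
      using mult_left_mono[OF norm_blinfun[of S u] norm_ge_zero[of d]]
      by (simp add: norm_scale mult.assoc)
  qed simp
  show "norm (scale_op scale c T) = norm c * norm T"
  proof (cases "c = 0")
    case True
    then show ?thesis using le[of c T] by simp
  next
    case False
    have "scale_op scale (inverse c) (scale_op scale c T) = T"
      using False by (intro blinfun_eqI) simp
    then have "norm T \<le> norm (inverse c) * norm (scale_op scale c T)"
      using le[of "inverse c" "scale_op scale c T"] by simp
    then have "norm c * norm T \<le> norm (scale_op scale c T)"
      using False by (simp add: norm_divide field_simps)
    with le[of c T] show ?thesis by simp
  qed
qed (auto intro!: blinfun_eqI simp: blinfun.add_left blinfun.scaleR_left scale_of_real
      scale_right_distrib scale_left_distrib)

text \<open>
  A map \<open>f\<close> from \<open>U \<subseteq> E\<close> into the subspace \<open>G\<close> of \<open>F\<close> is represented by a total function of which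
  only the values on \<open>U\<close> matter.
\<close>

definition has_deriv_at ::
  "('k \<Rightarrow> 'e \<Rightarrow> 'e) \<Rightarrow> ('k \<Rightarrow> 'f \<Rightarrow> 'f) \<Rightarrow> 'f set \<Rightarrow> 'e set \<Rightarrow>
   ('e::real_normed_vector \<Rightarrow> 'f::real_normed_vector) \<Rightarrow> 'e \<Rightarrow> ('e \<Rightarrow>\<^sub>L 'f) \<Rightarrow> bool"
  where "has_deriv_at sE sF G U f x D \<longleftrightarrow>
    (\<exists>\<Phi>. (\<forall>y\<in>U. \<Phi> y \<in> bounded_ops sE sF G) \<and>
         continuous (at x within U) \<Phi> \<and>
         (\<forall>y\<in>U. f y = f x + blinfun_apply (\<Phi> y) (y - x)) \<and>
         D = \<Phi> x)"

text \<open>For open \<open>U\<close> and \<open>x \<in> U\<close> the derivatives below are unique where they exist.\<close>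

definition deriv_at ::
  "('k \<Rightarrow> 'e \<Rightarrow> 'e) \<Rightarrow> ('k \<Rightarrow> 'f \<Rightarrow> 'f) \<Rightarrow> 'e set \<Rightarrow>
   ('e::real_normed_vector \<Rightarrow> 'f::real_normed_vector) \<Rightarrow> 'e \<Rightarrow> ('e \<Rightarrow>\<^sub>L 'f)"
  where "deriv_at sE sF U f x = (THE D. has_deriv_at sE sF UNIV U f x D)"

definition has_second_deriv_at ::
  "('k \<Rightarrow> 'e \<Rightarrow> 'e) \<Rightarrow> ('k \<Rightarrow> 'f \<Rightarrow> 'f) \<Rightarrow> 'e set \<Rightarrow>
   ('e::real_normed_vector \<Rightarrow> 'f::real_normed_vector) \<Rightarrow> 'e \<Rightarrow> ('e \<Rightarrow>\<^sub>L ('e \<Rightarrow>\<^sub>L 'f)) \<Rightarrow> bool"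
  where "has_second_deriv_at sE sF U f x Q \<longleftrightarrow>
    (\<exists>V. open V \<and> x \<in> V \<and> V \<subseteq> U \<and>
         (\<forall>y\<in>V. \<exists>D. has_deriv_at sE sF UNIV U f y D) \<and>
         has_deriv_at sE (scale_op sF) (bounded_ops sE sF UNIV) V (deriv_at sE sF U f) x Q)"

definition second_deriv_at ::
  "('k \<Rightarrow> 'e \<Rightarrow> 'e) \<Rightarrow> ('k \<Rightarrow> 'f \<Rightarrow> 'f) \<Rightarrow> 'e set \<Rightarrow>
   ('e::real_normed_vector \<Rightarrow> 'f::real_normed_vector) \<Rightarrow> 'e \<Rightarrow> ('e \<Rightarrow>\<^sub>L ('e \<Rightarrow>\<^sub>L 'f))"
  where "second_deriv_at sE sF U f x = (THE Q. has_second_deriv_at sE sF U f x Q)"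

end

theory Submission
  imports Defs
begin

text \<open>
  The second difference \<open>f (x + u + v) - f (x + u) - f (x + v) + f x\<close> is symmetric in \<open>u\<close> and
  \<open>v\<close>. It is the increment along \<open>v\<close> of the map \<open>y \<mapsto> f (y + u) - f y\<close>, whose derivative
  \<open>Df (y + u) - Df y\<close> differs from \<open>Q u\<close> by an error of first order in \<open>norm u + norm v\<close> with
  an arbitrarily small constant, because \<open>Q\<close> is the derivative of \<open>Df\<close> at the single point \<open>x\<close>.
  The mean value inequality therefore makes the second difference equal to \<open>Q u v\<close> up to a small
  multiple of \<open>(norm u + norm v)\<^sup>2\<close> (\<open>second_difference_bound\<close>). Exchanging \<open>u\<close> and \<open>v\<close> bounds
  \<open>Q u v - Q v u\<close> by such a multiple for small \<open>u\<close> and \<open>v\<close>; both sides are homogeneous of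
  degree two, so the bound holds for all \<open>u\<close> and \<open>v\<close>, and letting the constant tend to zero
  gives symmetry (\<open>second_derivative_symmetric\<close>).

  All of this takes place in real Frechet calculus. A derivative in the sense of
  \<open>has_deriv_at\<close> is a Frechet derivative (\<open>has_deriv_at_imp_has_derivative\<close>), and uniqueness
  of the latter makes the definite descriptions in \<open>deriv_at\<close> and \<open>second_deriv_at\<close> denote
  the derivatives that are assumed to exist.
\<close>

text \<open>
  The difference quotient of the error \<open>f y - f x - D (y - x) = (\<Phi> y - D) (y - x)\<close> is at most the
  operator norm of \<open>\<Phi> y - \<Phi> x\<close>, which vanishes at \<open>x\<close> by continuity of \<open>\<Phi>\<close>. Openness of \<open>U\<close>
  makes the limit within \<open>U\<close> a full one.
\<close>

lemma has_deriv_at_imp_has_derivative: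
  assumes "has_deriv_at sE sF G U f x D" "open U" "x \<in> U"
  shows "(f has_derivative blinfun_apply D) (at x)"
proof -
  obtain \<Phi> where cont: "continuous (at x within U) \<Phi>"
    and fact: "\<And>y. y \<in> U \<Longrightarrow> f y = f x + blinfun_apply (\<Phi> y) (y - x)"
    and D: "D = \<Phi> x"
    using assms(1) unfolding has_deriv_at_def by blast
  have "((\<lambda>y. norm (\<Phi> y - D)) \<longlongrightarrow> 0) (at x within U)"
    using cont unfolding continuous_within D by (simp add: LIM_zero tendsto_norm_zero)
  moreover have "\<forall>\<^sub>F y in at x within U.
      norm ((f y - f x - blinfun_apply D (y - x)) /\<^sub>R norm (y - x)) \<le> norm (\<Phi> y - D)"
    unfolding eventually_at_filter
  proof (intro always_eventually allI impI)
    fix y assume "y \<noteq> x" "y \<in> U"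
    have "f y - f x - blinfun_apply D (y - x) = blinfun_apply (\<Phi> y - D) (y - x)"
      using fact[OF \<open>y \<in> U\<close>] by (simp add: blinfun.diff_left)
    then show "norm ((f y - f x - blinfun_apply D (y - x)) /\<^sub>R norm (y - x)) \<le> norm (\<Phi> y - D)"
      using norm_blinfun[of "\<Phi> y - D" "y - x"] \<open>y \<noteq> x\<close> by (simp add: field_simps)
  qed
  ultimately have "((\<lambda>y. (f y - f x - blinfun_apply D (y - x)) /\<^sub>R norm (y - x)) \<longlongrightarrow> 0)
      (at x within U)"
    by (rule Lim_null_comparison[rotated])
  then show ?thesis
    using assms(2,3) at_within_open[of x U]
    by (simp add: has_derivative_at_within blinfun.bounded_linear_right)
qed

lemma has_deriv_at_unique:
  assumes "has_deriv_at sE sF G U f x D" "has_deriv_at sE sF G U f x D'" "open U" "x \<in> U"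
  shows "D = D'"
  using has_derivative_unique[OF assms(1,2)[THEN has_deriv_at_imp_has_derivative, OF assms(3,4)]]
  by (simp add: blinfun_apply_inject)

lemma deriv_at_has_derivative:
  assumes "\<exists>D. has_deriv_at sE sF UNIV U f x D" "open U" "x \<in> U"
  shows "(f has_derivative blinfun_apply (deriv_at sE sF U f x)) (at x)"
proof -
  have "\<exists>!D. has_deriv_at sE sF UNIV U f x D"
    using assms has_deriv_at_unique by blast
  then have "has_deriv_at sE sF UNIV U f x (deriv_at sE sF U f x)"
    unfolding deriv_at_def by (rule theI')
  then show ?thesis
    using assms(2,3) by (rule has_deriv_at_imp_has_derivative)
qed

text \<open>
  The second derivative may be witnessed on different neighbourhoods \<open>V\<close>. All of them
  differentiate the same function \<open>deriv_at sE sF U f\<close> at the same point, which is why its value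
  does not depend on \<open>V\<close>.
\<close>

lemma has_second_deriv_at_unique:
  assumes "has_second_deriv_at sE sF U f x Q" "has_second_deriv_at sE sF U f x Q'"
  shows "Q = Q'"
proof -
  have "(deriv_at sE sF U f has_derivative blinfun_apply R) (at x)"
    if "has_second_deriv_at sE sF U f x R" for R
    using that unfolding has_second_deriv_at_def
    by (blast intro: has_deriv_at_imp_has_derivative)
  with assms show ?thesis
    by (metis has_derivative_unique blinfun_apply_inject)
qed

text \<open>
  This is the mean value inequality for \<open>y \<mapsto> f (y + u) - f y - Q u y\<close> on the segment from \<open>x\<close>
  to \<open>x + v\<close>. The estimate on \<open>f'\<close> is used at \<open>y + u\<close> and at \<open>y\<close>, both at distance at most
  \<open>norm u + norm v\<close> from \<open>x\<close>; hence the factor two.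
\<close>

lemma second_difference_bound:
  fixes f :: "'a::real_normed_vector \<Rightarrow> 'b::real_normed_vector"
    and f' :: "'a \<Rightarrow> 'a \<Rightarrow>\<^sub>L 'b" and Q :: "'a \<Rightarrow>\<^sub>L 'a \<Rightarrow>\<^sub>L 'b"
  assumes deriv: "\<And>y. y \<in> ball x d \<Longrightarrow> (f has_derivative blinfun_apply (f' y)) (at y)"
    and approx: "\<And>y. y \<in> ball x d \<Longrightarrow> norm (f' y - f' x - blinfun_apply Q (y - x)) \<le> e * norm (y - x)"
    and "e \<ge> 0" and small: "norm u + norm v < d"
  shows "norm (f (x + u + v) - f (x + u) - f (x + v) + f x - blinfun_apply (blinfun_apply Q u) v)
         \<le> 2 * e * (norm u + norm v) * norm v"
proof -
  define S where "S = closed_segment x (x + v)"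
  define g where "g y = f (y + u) - f y - blinfun_apply (blinfun_apply Q u) y" for y
  define g' where "g' y = f' (y + u) - f' y - blinfun_apply Q u" for y
  let ?B = "2 * e * (norm u + norm v)"
  have close: "norm (y - x) \<le> norm v" if "y \<in> S" for y
    using that segment_bound(1)[of y x "x + v"] by (simp add: S_def)
  have dist_le: "norm (y + u - x) \<le> norm u + norm v" "norm (y - x) \<le> norm u + norm v"
    if "y \<in> S" for y
    using close[OF that] norm_triangle_ineq[of "y - x" u] norm_ge_zero[of u]
    by (simp_all only: diff_add_eq)
  have inball: "y + u \<in> ball x d" "y \<in> ball x d" if "y \<in> S" for y
    using dist_le[OF that] small by (simp_all add: dist_norm norm_minus_commute)
  have "norm (g (x + v) - g x) \<le> ?B * norm (x + v - x)"
  proof (rule differentiable_bound[where S = S and f' = "\<lambda>y. blinfun_apply (g' y)"])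
    show "convex S" "x + v \<in> S" "x \<in> S"
      by (auto simp: S_def)
    fix y assume "y \<in> S"
    have "((\<lambda>y. f (y + u)) has_derivative blinfun_apply (f' (y + u))) (at y)"
      using has_derivative_compose[of "\<lambda>y. y + u" "\<lambda>h. h" y UNIV f]
        deriv[OF inball(1)[OF \<open>y \<in> S\<close>]]
      by (simp add: has_derivative_add_const)
    then have "(g has_derivative (\<lambda>h. blinfun_apply (f' (y + u)) h - blinfun_apply (f' y) h
        - blinfun_apply (blinfun_apply Q u) h)) (at y)"
      unfolding g_def
      by (intro has_derivative_diff deriv[OF inball(2)[OF \<open>y \<in> S\<close>]]
          bounded_linear_imp_has_derivative blinfun.bounded_linear_right)
    moreover have "blinfun_apply (g' y) = (\<lambda>h. blinfun_apply (f' (y + u)) h - blinfun_apply (f' y) h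
        - blinfun_apply (blinfun_apply Q u) h)"
      by (simp add: fun_eq_iff g'_def blinfun.diff_left)
    ultimately show "(g has_derivative blinfun_apply (g' y)) (at y within S)"
      by (simp add: has_derivative_at_withinI)
    have "g' y = (f' (y + u) - f' x - blinfun_apply Q (y + u - x))
               - (f' y - f' x - blinfun_apply Q (y - x))"
      by (simp add: g'_def blinfun.diff_right blinfun.add_right)
    then have "norm (g' y) \<le> norm (f' (y + u) - f' x - blinfun_apply Q (y + u - x))
               + norm (f' y - f' x - blinfun_apply Q (y - x))"
      by (simp only: norm_triangle_ineq4)
    also have "\<dots> \<le> e * (norm u + norm v) + e * (norm u + norm v)"
      using inball[OF \<open>y \<in> S\<close>] dist_le[OF \<open>y \<in> S\<close>] \<open>e \<ge> 0\<close>
      by (intro add_mono order_trans[OF approx] mult_left_mono)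
    finally show "onorm (blinfun_apply (g' y)) \<le> ?B"
      by (simp add: norm_blinfun.rep_eq)
  qed
  moreover have "g (x + v) - g x = f (x + u + v) - f (x + u) - f (x + v) + f x
      - blinfun_apply (blinfun_apply Q u) v"
    by (simp add: g_def blinfun.add_right algebra_simps)
  ultimately show ?thesis by simp
qed

text \<open>
  The increments \<open>u\<close> and \<open>v\<close> are shrunk by a factor \<open>s\<close> until they fit into a ball on which
  \<open>f'\<close> is within \<open>e * norm (y - x)\<close> of its linearization. Bilinearity of \<open>Q\<close> and the quadratic
  error term both contribute \<open>s\<^sup>2\<close>, which cancels and leaves an estimate for the original \<open>u\<close>
  and \<open>v\<close> in which \<open>e\<close> is arbitrary, although \<open>s\<close> depends on \<open>e\<close>.
\<close>

lemma second_derivative_symmetric: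
  fixes f :: "'a::real_normed_vector \<Rightarrow> 'b::real_normed_vector"
    and f' :: "'a \<Rightarrow> 'a \<Rightarrow>\<^sub>L 'b" and Q :: "'a \<Rightarrow>\<^sub>L 'a \<Rightarrow>\<^sub>L 'b"
  assumes "open V" "x \<in> V"
    and deriv: "\<And>y. y \<in> V \<Longrightarrow> (f has_derivative blinfun_apply (f' y)) (at y)"
    and deriv2: "(f' has_derivative blinfun_apply Q) (at x)"
  shows "blinfun_apply (blinfun_apply Q u) v = blinfun_apply (blinfun_apply Q v) u"
proof -
  define A where "A u v = blinfun_apply (blinfun_apply Q u) v" for u v
  let ?n = "norm u + norm v"
  have bound: "norm (A u v - A v u) \<le> e * (2 * ?n\<^sup>2)" if "e > 0" for e
  proof -
    obtain d1 where d1: "d1 > 0" "ball x d1 \<subseteq> V"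
      using assms(1,2) openE by blast
    obtain d2 where d2: "d2 > 0"
      "\<And>y. norm (y - x) < d2 \<Longrightarrow> norm (f' y - f' x - blinfun_apply Q (y - x)) \<le> e * norm (y - x)"
      using deriv2 \<open>e > 0\<close> unfolding has_derivative_at_alt by blast
    define d where "d = min d1 d2"
    have deriv': "(f has_derivative blinfun_apply (f' y)) (at y)" if "y \<in> ball x d" for y
      using that d1(2) by (intro deriv) (auto simp: d_def)
    have approx: "norm (f' y - f' x - blinfun_apply Q (y - x)) \<le> e * norm (y - x)"
      if "y \<in> ball x d" for y
      using that by (intro d2(2)) (simp add: d_def dist_norm norm_minus_commute)
    \<comment> \<open>The one in the denominator makes the inequality \<open>s * ?n < d\<close> strict and covers \<open>u = v = 0\<close>.\<close>
    define s where "s = d / (?n + 1)"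
    have "d > 0" using d1 d2 by (simp add: d_def)
    have pos: "?n + 1 > 0" by (simp add: add_nonneg_pos)
    have "s > 0" using \<open>d > 0\<close> pos by (simp add: s_def)
    have small: "norm (s *\<^sub>R u) + norm (s *\<^sub>R v) < d"
    proof -
      have "s * ?n < s * (?n + 1)" using \<open>s > 0\<close> by simp
      also have "\<dots> = d" using pos by (simp add: s_def)
      finally show ?thesis using \<open>s > 0\<close> by (simp add: distrib_left)
    qed
    let ?\<Delta> = "f (x + s *\<^sub>R u + s *\<^sub>R v) - f (x + s *\<^sub>R u) - f (x + s *\<^sub>R v) + f x"
    have 1: "norm (?\<Delta> - A (s *\<^sub>R u) (s *\<^sub>R v)) \<le> 2 * e * (s * ?n) * (s * norm v)"
      using second_difference_bound[OF deriv' approx _ small] \<open>e > 0\<close> \<open>s > 0\<close>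
      by (simp add: A_def distrib_left)
    have 2: "norm (?\<Delta> - A (s *\<^sub>R v) (s *\<^sub>R u)) \<le> 2 * e * (s * ?n) * (s * norm u)"
      using second_difference_bound[OF deriv' approx, where u = "s *\<^sub>R v" and v = "s *\<^sub>R u"] small \<open>e > 0\<close> \<open>s > 0\<close>
      by (simp add: A_def algebra_simps)
    have "s\<^sup>2 * norm (A u v - A v u) = norm (A (s *\<^sub>R u) (s *\<^sub>R v) - A (s *\<^sub>R v) (s *\<^sub>R u))"
      by (simp add: A_def blinfun.scaleR_left blinfun.scaleR_right power2_eq_square
          flip: scaleR_diff_right)
    also have "\<dots> = norm ((?\<Delta> - A (s *\<^sub>R v) (s *\<^sub>R u)) - (?\<Delta> - A (s *\<^sub>R u) (s *\<^sub>R v)))"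
      by simp
    also have "\<dots> \<le> 2 * e * (s * ?n) * (s * norm u) + 2 * e * (s * ?n) * (s * norm v)"
      using 1 2 by (rule order_trans[OF norm_triangle_ineq4 add_mono, rotated])
    also have "\<dots> = s\<^sup>2 * (e * (2 * ?n\<^sup>2))"
      by (simp add: power2_eq_square algebra_simps)
    finally show ?thesis using \<open>s > 0\<close> by simp
  qed
  have "norm (A u v - A v u) \<le> 0"
  proof (rule tendsto_lowerbound)
    show "((\<lambda>e. e * (2 * ?n\<^sup>2)) \<longlongrightarrow> 0) (at_right 0)"
      by (rule tendsto_mult_left_zero) (rule tendsto_ident_at)
    show "\<forall>\<^sub>F e in at_right 0. norm (A u v - A v u) \<le> e * (2 * ?n\<^sup>2)"
      using bound by (auto intro: eventually_mono[OF eventually_at_right_less])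
  qed simp
  then show ?thesis by (simp add: A_def)
qed

theorem theorem5p1:
  fixes sE :: "'k::real_normed_field \<Rightarrow> 'e::banach \<Rightarrow> 'e"
    and sF :: "'k \<Rightarrow> 'f::banach \<Rightarrow> 'f"
    and U :: "'e set" and f :: "'e \<Rightarrow> 'f" and x :: 'e
  assumes "banach_over sE" and "banach_over sF"
    and "open U" and "x \<in> U"
    and "\<exists>Q. has_second_deriv_at sE sF U f x Q"
  shows "\<forall>u v. blinfun_apply (blinfun_apply (second_deriv_at sE sF U f x) u) v =
               blinfun_apply (blinfun_apply (second_deriv_at sE sF U f x) v) u"
proof -
  let ?Q = "second_deriv_at sE sF U f x"
  have "\<exists>!Q. has_second_deriv_at sE sF U f x Q"
    using assms(5) has_second_deriv_at_unique by blast
  then have "has_second_deriv_at sE sF U f x ?Q"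
    unfolding second_deriv_at_def by (rule theI')
  then obtain V where V: "open V" "x \<in> V" "V \<subseteq> U"
    and D: "\<And>y. y \<in> V \<Longrightarrow> \<exists>D. has_deriv_at sE sF UNIV U f y D"
    and Q: "has_deriv_at sE (scale_op sF) (bounded_ops sE sF UNIV) V (deriv_at sE sF U f) x ?Q"
    unfolding has_second_deriv_at_def by blast
  have "(f has_derivative blinfun_apply (deriv_at sE sF U f y)) (at y)" if "y \<in> V" for y
    using D[OF that] assms(3) that V(3) by (intro deriv_at_has_derivative) auto
  then show ?thesis
    using second_derivative_symmetric[OF V(1,2)] has_deriv_at_imp_has_derivative[OF Q V(1,2)]
    by blast
qed

end
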